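(* Let $G$ be a finitely generated group acting by homeomorphisms on a compact Polish space $X$. Then the action $G\curvearrowright X$ is sensitive to initial conditions if and only if the pseudogroup on $X$ generated by the action is sensitive to initial conditions.
   Context: Metrics may take the value $\infty$; a metric on a topological space is compatible if its open balls generate the topology. Sensitivity of a group action: an action $G\curvearrowright X$ by homeomorphisms on a space with compatible metric $d$ is sensitive to initial conditions if there is $c>0$ such that for every $x\in X$ and $r>0$ there are $y\in B(x,r)$ and $g\in G$ with $d(gx,gy)\ge c$. (For compact $X$ this does not depend on the choice of compatible metric.) Pseudogroups: $\mathrm{Ph}(X)$ is the set of partial homeomorphisms of $X$, i.e. homeomorphisms $f\colon\mathrm{dom} f\to\mathrm{im} f$ between open subsets of $X$; the composition $gf$ has domain $f^{-1}(\mathrm{dom}\, g)$. A pseudo$*$group on $X$ is a subset of $\mathrm{Ph}(X)$ containing $\mathrm{id}_X$ and closed under inversion, composition and restriction to open subsets of domains. A pseudogroup on $X$ is a pseudo$*$group $\mathcal G$ that is also closed under combinations: if $f\in\mathrm{Ph}(X)$ and every $x\in\mathrm{dom} f$ has an open neighborhood $U_x$ with $f|_{U_x}\in\mathcal G$, then $f\in\mathcal G$. A subset $S\subset\mathcal G$ generates $\mathcal G$ if $\mathcal G$ is the smallest pseudogroup containing $S$. The pseudogroup generated by an action $G\curvearrowright X$ is the smallest pseudogroup containing all homeomorphisms $x\mapsto gx$, $g\in G$. Sensitivity of a pseudogroup: given a compatible metric $d$ on $X$ and a pseudo$*$group $\mathcal S\subset\mathcal G$ generating $\mathcal G$, $\mathcal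 G$ is $(\mathcal S,d)$-sensitive if there is $c>0$ such that for every $x\in X$ and $r>0$ there are $s\in\mathcal S$ and $y$ with $x,y\in\mathrm{dom}\, s$, $d(x,y)<r$ and $d(sx,sy)\ge c$. $\mathcal G$ is sensitive to initial conditions if it is $(\mathcal S,d)$-sensitive for every generating pseudo$*$group $\mathcal S$ and every compatible metric $d$. *)

theory Defs
  imports "HOL-Analysis.Analysis" "HOL-Algebra.Group_Action" "HOL-Algebra.Generated_Groups"
begin

section \<open>Compatible metrics\<close>

text \<open>Metrics take values in \<open>[0, \<infinity>]\<close>. The radii of balls are finite; a ball of infinite
  radius is the union of the balls of finite radius with the same centre.\<close>

definition ext_metric_on :: "'a set \<Rightarrow> ('a \<Rightarrow> 'a \<Rightarrow> ennreal) \<Rightarrow> bool" where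
  "ext_metric_on M d \<longleftrightarrow>
     (\<forall>x\<in>M. \<forall>y\<in>M. d x y = 0 \<longleftrightarrow> x = y) \<and>
     (\<forall>x\<in>M. \<forall>y\<in>M. d x y = d y x) \<and>
     (\<forall>x\<in>M. \<forall>y\<in>M. \<forall>z\<in>M. d x z \<le> d x y + d y z)"

definition ext_ball :: "'a set \<Rightarrow> ('a \<Rightarrow> 'a \<Rightarrow> ennreal) \<Rightarrow> 'a \<Rightarrow> real \<Rightarrow> 'a set" where
  "ext_ball M d x r = {y \<in> M. d x y < ennreal r}"

definition compatible_metric :: "'a topology \<Rightarrow> ('a \<Rightarrow> 'a \<Rightarrow> ennreal) \<Rightarrow> bool" where
  "compatible_metric X d \<longleftrightarrow>
     ext_metric_on (topspace X) d \<and>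
     X = topology_generated_by {ext_ball (topspace X) d x r | x r. x \<in> topspace X \<and> 0 < r}"

definition polish_topology :: "'a topology \<Rightarrow> bool" where
  "polish_topology X \<longleftrightarrow> separable_space X \<and> completely_metrizable_space X"

section \<open>Group actions by homeomorphisms\<close>

definition finitely_generated_group :: "('g, 'b) monoid_scheme \<Rightarrow> bool" where
  "finitely_generated_group G \<longleftrightarrow>
     group G \<and> (\<exists>A. finite A \<and> A \<subseteq> carrier G \<and> generate G A = carrier G)"

definition action_by_homeos ::
    "('g, 'b) monoid_scheme \<Rightarrow> 'a topology \<Rightarrow> ('g \<Rightarrow> 'a \<Rightarrow> 'a) \<Rightarrow> bool" where
  "action_by_homeos G X \<phi> \<longleftrightarrow>
     group_action G (topspace X) \<phi> \<and> (\<forall>g\<in>carrier G. homeomorphic_map X X (\<phi> g))"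

definition action_sensitive ::
    "('g, 'b) monoid_scheme \<Rightarrow> 'a topology \<Rightarrow> ('g \<Rightarrow> 'a \<Rightarrow> 'a) \<Rightarrow> ('a \<Rightarrow> 'a \<Rightarrow> ennreal) \<Rightarrow> bool" where
  "action_sensitive G X \<phi> d \<longleftrightarrow>
     (\<exists>c::real. 0 < c \<and>
        (\<forall>x\<in>topspace X. \<forall>r>0. \<exists>y\<in>ext_ball (topspace X) d x r. \<exists>g\<in>carrier G.
           ennreal c \<le> d (\<phi> g x) (\<phi> g y)))"

section \<open>Pseudogroups\<close>

text \<open>A partial map is a function into \<^typ>\<open>'a option\<close>, so that it carries its domain \<^term>\<open>dom f\<close>,
  and \<^term>\<open>ran f\<close> is its image. Equality of such maps is equality of partial functions,
  \<^term>\<open>g \<circ>\<^sub>m f\<close> has domain the preimage of \<^term>\<open>dom g\<close> under \<^term>\<open>f\<close>, and \<^term>\<open>f |` U\<close> is restriction.\<close>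

definition Ph :: "'a topology \<Rightarrow> ('a \<rightharpoonup> 'a) set" where
  "Ph X = {f. openin X (dom f) \<and> openin X (ran f) \<and>
     homeomorphic_map (subtopology X (dom f)) (subtopology X (ran f)) (\<lambda>x. the (f x))}"

definition map_inv :: "('a \<rightharpoonup> 'b) \<Rightarrow> ('b \<rightharpoonup> 'a)" where
  "map_inv f = (\<lambda>y. if y \<in> ran f then Some (THE x. f x = Some y) else None)"

definition pseudo_star_group :: "'a topology \<Rightarrow> ('a \<rightharpoonup> 'a) set \<Rightarrow> bool" where
  "pseudo_star_group X \<G> \<longleftrightarrow>
     \<G> \<subseteq> Ph X \<and>
     Some |` topspace X \<in> \<G> \<and>
     (\<forall>f\<in>\<G>. map_inv f \<in> \<G>) \<and>
     (\<forall>f\<in>\<G>. \<forall>g\<in>\<G>. g \<circ>\<^sub>m f \<in> \<G>) \<and>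
     (\<forall>f\<in>\<G>. \<forall>U. openin X U \<and> U \<subseteq> dom f \<longrightarrow> f |` U \<in> \<G>)"

definition pseudogroup :: "'a topology \<Rightarrow> ('a \<rightharpoonup> 'a) set \<Rightarrow> bool" where
  "pseudogroup X \<G> \<longleftrightarrow>
     pseudo_star_group X \<G> \<and>
     (\<forall>f\<in>Ph X. (\<forall>x\<in>dom f. \<exists>U. openin X U \<and> x \<in> U \<and> f |` U \<in> \<G>) \<longrightarrow> f \<in> \<G>)"

text \<open>For \<^term>\<open>S \<subseteq> Ph X\<close> this is the least pseudogroup containing \<^term>\<open>S\<close>: see
  \<open>pseudogroup_generated_pseudogroup\<close> below.\<close>

definition generated_pseudogroup :: "'a topology \<Rightarrow> ('a \<rightharpoonup> 'a) set \<Rightarrow> ('a \<rightharpoonup> 'a) set" where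
  "generated_pseudogroup X S = pseudogroup X hull S"

definition action_pseudogroup ::
    "('g, 'b) monoid_scheme \<Rightarrow> 'a topology \<Rightarrow> ('g \<Rightarrow> 'a \<Rightarrow> 'a) \<Rightarrow> ('a \<rightharpoonup> 'a) set" where
  "action_pseudogroup G X \<phi> =
     generated_pseudogroup X {(\<lambda>x. Some (\<phi> g x)) |` topspace X | g. g \<in> carrier G}"

definition pseudo_star_group_sensitive ::
    "'a topology \<Rightarrow> ('a \<rightharpoonup> 'a) set \<Rightarrow> ('a \<Rightarrow> 'a \<Rightarrow> ennreal) \<Rightarrow> bool" where
  "pseudo_star_group_sensitive X S d \<longleftrightarrow>
     (\<exists>c::real. 0 < c \<and>
        (\<forall>x\<in>topspace X. \<forall>r::real. 0 < r \<longrightarrow>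
           (\<exists>s\<in>S. \<exists>y. x \<in> dom s \<and> y \<in> dom s \<and> d x y < ennreal r \<and>
              ennreal c \<le> d (the (s x)) (the (s y)))))"

definition pseudogroup_sensitive :: "'a topology \<Rightarrow> ('a \<rightharpoonup> 'a) set \<Rightarrow> bool" where
  "pseudogroup_sensitive X \<G> \<longleftrightarrow>
     (\<forall>S d. pseudo_star_group X S \<and> S \<subseteq> \<G> \<and> generated_pseudogroup X S = \<G> \<and>
        compatible_metric X d \<longrightarrow> pseudo_star_group_sensitive X S d)"


lemma in_Ph_iff:
  "f \<in> Ph X \<longleftrightarrow> openin X (dom f) \<and> openin X (ran f) \<and> inj_on (\<lambda>x. the (f x)) (dom f) \<and>
     (\<forall>U. openin X U \<longrightarrow> openin X {x \<in> dom f. the (f x) \<in> U}) \<and>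
     (\<forall>U. openin X U \<and> U \<subseteq> dom f \<longrightarrow> openin X ((\<lambda>x. the (f x)) ` U))"
  (is "?L \<longleftrightarrow> ?R")
proof -
  let ?f = "\<lambda>x. the (f x)"
  have ran: "ran f = ?f ` dom f"
    by (force simp: ran_def dom_def image_iff)
  { assume o: "openin X (dom f)" "openin X (ran f)"
    have td: "topspace (subtopology X (dom f)) = dom f" "topspace (subtopology X (ran f)) = ran f"
      using o openin_subset by fastforce+
    have op: "openin (subtopology X (dom f)) U \<longleftrightarrow> openin X U \<and> U \<subseteq> dom f"
       "openin (subtopology X (ran f)) U \<longleftrightarrow> openin X U \<and> U \<subseteq> ran f" for U
      using o by (auto simp: openin_open_subtopology)
    have "homeomorphic_map (subtopology X (dom f)) (subtopology X (ran f)) ?f \<longleftrightarrow>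
       continuous_map (subtopology X (dom f)) (subtopology X (ran f)) ?f \<and>
       open_map (subtopology X (dom f)) (subtopology X (ran f)) ?f \<and> inj_on ?f (dom f)"
      using td ran homeomorphic_eq_everything_map[of "subtopology X (dom f)" "subtopology X (ran f)" ?f]
        bijective_open_imp_homeomorphic_map[of "subtopology X (dom f)" "subtopology X (ran f)" ?f]
      by auto
    moreover have "open_map (subtopology X (dom f)) (subtopology X (ran f)) ?f \<longleftrightarrow>
       (\<forall>U. openin X U \<and> U \<subseteq> dom f \<longrightarrow> openin X (?f ` U))"
      unfolding open_map_def op using ran by blast
    moreover have "continuous_map (subtopology X (dom f)) (subtopology X (ran f)) ?f \<longleftrightarrow>
       (\<forall>U. openin X U \<longrightarrow> openin X {x \<in> dom f. ?f x \<in> U})"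
    proof -
      have e: "{x \<in> dom f. ?f x \<in> U} = {x \<in> dom f. ?f x \<in> U \<inter> ran f}" for U
        using ran by blast
      have i: "openin X (U \<inter> ran f)" if "openin X U" for U
        using o that by blast
      have "?f \<in> dom f \<rightarrow> ran f" using ran by blast
      moreover have "(\<forall>U. openin X U \<and> U \<subseteq> ran f \<longrightarrow> openin X {x \<in> dom f. ?f x \<in> U}) \<longleftrightarrow>
          (\<forall>U. openin X U \<longrightarrow> openin X {x \<in> dom f. ?f x \<in> U})"
        (is "?A \<longleftrightarrow> ?B")
      proof
        assume A: ?A
        show ?B
        proof (intro allI impI)
          fix U assume "openin X U"
          then show "openin X {x \<in> dom f. ?f x \<in> U}"
            unfolding e[of U] using A i by blast
        qed
      qed blast
      ultimately show ?thesis
        unfolding continuous_map_def td op by blast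
    qed
    ultimately have ?thesis unfolding Ph_def using o by blast }
  then show ?thesis unfolding Ph_def by blast
qed

lemma map_inv_in_Ph:
  assumes "f \<in> Ph X"
  shows "map_inv f \<in> Ph X"
proof -
  note f = assms[unfolded in_Ph_iff]
  have io: "inj_on (\<lambda>x. the (f x)) (dom f)" using f by blast
  have inj: "x = x'" if "f x = Some y" "f x' = Some y" for x x' y
    by (rule inj_onD[OF io]) (use that in auto)
  have eq: "map_inv f y = Some x \<longleftrightarrow> f x = Some y" for x y
  proof (cases "y \<in> ran f")
    case True
    then obtain z where z: "f z = Some y" by (auto simp: ran_def)
    have "(THE x. f x = Some y) = z" by (rule the_equality[of _ z]) (use z inj in blast)+
    then have "map_inv f y = Some z" using True by (simp add: map_inv_def)
    moreover have "f x = Some y \<longleftrightarrow> z = x" using z inj by blast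
    ultimately show ?thesis by simp
  next
    case False
    then show ?thesis by (auto simp: map_inv_def ran_def)
  qed
  have d: "dom (map_inv f) = ran f" by (auto simp: map_inv_def split: if_splits)
  have r: "ran (map_inv f) = dom f" by (auto simp: ran_def dom_def eq)
  have v: "f (the (map_inv f y)) = Some y" if "y \<in> ran f" for y
  proof -
    have "y \<in> dom (map_inv f)" using that unfolding d .
    then obtain x where "map_inv f y = Some x" by blast
    then show ?thesis using eq[of y x] by simp
  qed
  have "inj_on (\<lambda>y. the (map_inv f y)) (ran f)"
  proof (rule inj_onI)
    fix y z assume yz: "y \<in> ran f" "z \<in> ran f" "the (map_inv f y) = the (map_inv f z)"
    have "Some y = Some z" using v[OF yz(1)] v[OF yz(2)] unfolding yz(3) by (rule trans[OF sym])
    then show "y = z" by simp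
  qed
  moreover have "openin X {y \<in> ran f. the (map_inv f y) \<in> U}" if "openin X U" for U
  proof -
    have e: "{y \<in> ran f. the (map_inv f y) \<in> U} = (\<lambda>x. the (f x)) ` (U \<inter> dom f)"
    proof (intro subset_antisym subsetI)
      fix y assume "y \<in> {y \<in> ran f. the (map_inv f y) \<in> U}"
      then have "f (the (map_inv f y)) = Some y" "the (map_inv f y) \<in> U" using v by auto
      then show "y \<in> (\<lambda>x. the (f x)) ` (U \<inter> dom f)"
        by (intro image_eqI[of _ _ "the (map_inv f y)"]) auto
    next
      fix y assume "y \<in> (\<lambda>x. the (f x)) ` (U \<inter> dom f)"
      then obtain x where "x \<in> U" "f x = Some y" by auto
      then show "y \<in> {y \<in> ran f. the (map_inv f y) \<in> U}"
        using eq[of y x] by (auto intro: ranI)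
    qed
    have "openin X (U \<inter> dom f)" using that f by blast
    then show ?thesis unfolding e using f by blast
  qed
  moreover have "openin X ((\<lambda>y. the (map_inv f y)) ` V)" if V: "openin X V" "V \<subseteq> ran f" for V
  proof -
    have e: "(\<lambda>y. the (map_inv f y)) ` V = {x \<in> dom f. the (f x) \<in> V}"
    proof (intro subset_antisym subsetI)
      fix x assume "x \<in> (\<lambda>y. the (map_inv f y)) ` V"
      then obtain y where "y \<in> V" "x = the (map_inv f y)" by blast
      moreover from this have "f x = Some y" using v V(2) by blast
      ultimately show "x \<in> {x \<in> dom f. the (f x) \<in> V}" by auto
    next
      fix x assume "x \<in> {x \<in> dom f. the (f x) \<in> V}"
      then obtain y where "f x = Some y" "y \<in> V" by auto
      then show "x \<in> (\<lambda>y. the (map_inv f y)) ` V"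
        using eq[of y x] by (intro image_eqI[of _ _ y]) auto
    qed
    show ?thesis unfolding e using f V(1) by blast
  qed
  moreover have "openin X (dom f)" "openin X (ran f)" using f by blast+
  ultimately show ?thesis
    unfolding in_Ph_iff d r by blast
qed

lemma map_comp_in_Ph:
  assumes "f \<in> Ph X" "g \<in> Ph X"
  shows "g \<circ>\<^sub>m f \<in> Ph X"
proof -
  let ?f = "\<lambda>x. the (f x)" and ?g = "\<lambda>x. the (g x)" and ?h = "\<lambda>x. the ((g \<circ>\<^sub>m f) x)"
  note f = assms(1)[unfolded in_Ph_iff] and g = assms(2)[unfolded in_Ph_iff]
  have d: "dom (g \<circ>\<^sub>m f) = {x \<in> dom f. ?f x \<in> dom g}"
    by (force simp: map_comp_def split: option.splits)
  have h: "?h x = ?g (?f x)" if "x \<in> dom (g \<circ>\<^sub>m f)" for x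
    using that by (auto simp: map_comp_def split: option.splits)
  have od: "openin X (dom (g \<circ>\<^sub>m f))" unfolding d using f g by blast
  have im: "openin X (?h ` U)" if "openin X U" "U \<subseteq> dom (g \<circ>\<^sub>m f)" for U
  proof -
    have "?h ` U = ?g ` (?f ` U)" using h that(2) by (force simp: image_iff)
    moreover have "openin X (?f ` U)" "?f ` U \<subseteq> dom g" using f that d by auto
    ultimately show ?thesis using g by auto
  qed
  have "ran (g \<circ>\<^sub>m f) = ?h ` dom (g \<circ>\<^sub>m f)"
    by (force simp: ran_def dom_def image_iff)
  then have "openin X (ran (g \<circ>\<^sub>m f))" using im od by simp
  moreover have "inj_on ?h (dom (g \<circ>\<^sub>m f))"
  proof (rule inj_onI)
    fix x y assume xy: "x \<in> dom (g \<circ>\<^sub>m f)" "y \<in> dom (g \<circ>\<^sub>m f)" "?h x = ?h y"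
    have "?g (?f x) = ?g (?f y)" using xy h by metis
    moreover have "?f x \<in> dom g" "?f y \<in> dom g" using xy unfolding d by blast+
    moreover have "inj_on ?g (dom g)" using g by blast
    ultimately have "?f x = ?f y" by (metis inj_on_def)
    moreover have "x \<in> dom f" "y \<in> dom f" using xy unfolding d by blast+
    moreover have "inj_on ?f (dom f)" using f by blast
    ultimately show "x = y" by (metis inj_on_def)
  qed
  moreover have "openin X {x \<in> dom (g \<circ>\<^sub>m f). ?h x \<in> U}" if "openin X U" for U
  proof -
    have e: "{x \<in> dom (g \<circ>\<^sub>m f). ?h x \<in> U} = {x \<in> dom f. ?f x \<in> {y \<in> dom g. ?g y \<in> U}}"
      using d h by auto
    have "openin X {y \<in> dom g. ?g y \<in> U}" using g that by blast
    then show ?thesis unfolding e using f by blast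
  qed
  ultimately show ?thesis unfolding in_Ph_iff using od im by blast
qed

lemma restrict_in_Ph:
  assumes "f \<in> Ph X" "openin X U"
  shows "f |` U \<in> Ph X"
proof -
  let ?f = "\<lambda>x. the (f x)" and ?h = "\<lambda>x. the ((f |` U) x)"
  note f = assms(1)[unfolded in_Ph_iff]
  have d: "dom (f |` U) = dom f \<inter> U" by simp
  have od: "openin X (dom (f |` U))" using f assms(2) by auto
  have im: "openin X (?h ` V)" if "openin X V" "V \<subseteq> dom (f |` U)" for V
  proof -
    have e: "?h ` V = ?f ` V" using that by (intro image_cong) auto
    have "V \<subseteq> dom f" using that(2) unfolding d by blast
    then show ?thesis unfolding e using f that(1) by blast
  qed
  have "ran (f |` U) = ?h ` dom (f |` U)"
    by (force simp: ran_def dom_def image_iff)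
  then have "openin X (ran (f |` U))" using im[OF od order_refl] by metis
  moreover have "inj_on ?h (dom (f |` U))"
  proof -
    have "inj_on ?f (dom f)" using f by blast
    then have "inj_on ?f (dom f \<inter> U)" by (rule inj_on_subset) blast
    then show ?thesis unfolding d by (rule inj_on_cong[THEN iffD1, rotated]) simp
  qed
  moreover have "openin X {x \<in> dom (f |` U). ?h x \<in> V}" if "openin X V" for V
  proof -
    have "{x \<in> dom (f |` U). ?h x \<in> V} = {x \<in> dom f. ?f x \<in> V} \<inter> U" by auto
    moreover have "openin X {x \<in> dom f. ?f x \<in> V}" using f that by blast
    ultimately show ?thesis using assms(2) by (simp add: openin_Int)
  qed
  ultimately show ?thesis unfolding in_Ph_iff using od im by blast
qed

lemma homeomorphic_map_in_Ph:
  assumes "homeomorphic_map X X h"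
  shows "(\<lambda>x. Some (h x)) |` topspace X \<in> Ph X"
proof -
  have d: "dom ((\<lambda>x. Some (h x)) |` topspace X) = topspace X" by auto
  have "ran ((\<lambda>x. Some (h x)) |` topspace X) = h ` topspace X"
    by (auto simp: ran_def restrict_map_def)
  then have r: "ran ((\<lambda>x. Some (h x)) |` topspace X) = topspace X"
    using assms by (simp add: homeomorphic_imp_surjective_map)
  have "homeomorphic_map X X (\<lambda>x. the (((\<lambda>x. Some (h x)) |` topspace X) x))"
    by (rule homeomorphic_map_eq[OF assms]) simp
  then show ?thesis unfolding Ph_def d r mem_Collect_eq by simp
qed

lemma pseudogroup_Ph: "pseudogroup X (Ph X)"
  unfolding pseudogroup_def pseudo_star_group_def
  using homeomorphic_map_in_Ph[of X "\<lambda>x. x"]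
  by (simp add: map_inv_in_Ph map_comp_in_Ph restrict_in_Ph homeomorphic_map_id[unfolded id_def])

lemma pseudogroup_Inter:
  assumes "\<And>\<G>. \<G> \<in> F \<Longrightarrow> pseudogroup X \<G>" "F \<noteq> {}"
  shows "pseudogroup X (\<Inter>F)"
proof -
  have ps: "\<And>\<G>. \<G> \<in> F \<Longrightarrow> pseudo_star_group X \<G>"
    using assms(1) unfolding pseudogroup_def by blast
  have comb: "f \<in> \<G>" if "\<G> \<in> F" "f \<in> Ph X"
      "\<forall>x\<in>dom f. \<exists>U. openin X U \<and> x \<in> U \<and> f |` U \<in> \<Inter>F" for f \<G>
    using assms(1)[OF that(1)] that(2,3) that(1) unfolding pseudogroup_def by (meson InterD)
  have "pseudo_star_group X (\<Inter>F)"
    using ps assms(2) unfolding pseudo_star_group_def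
    by (intro conjI) (blast | fast)+
  then show ?thesis using comb unfolding pseudogroup_def by blast
qed

lemma pseudogroup_generated_pseudogroup:
  assumes "S \<subseteq> Ph X"
  shows "pseudogroup X (generated_pseudogroup X S)"
  unfolding generated_pseudogroup_def hull_def
  using assms pseudogroup_Ph[of X] by (intro pseudogroup_Inter) auto

lemma subset_generated_pseudogroup: "S \<subseteq> generated_pseudogroup X S"
  unfolding generated_pseudogroup_def by (rule hull_subset)

lemma generated_pseudogroup_least:
  assumes "pseudogroup X \<G>" "S \<subseteq> \<G>"
  shows "generated_pseudogroup X S \<subseteq> \<G>"
  unfolding generated_pseudogroup_def using assms by (simp add: hull_minimal)

lemma pseudogroup_action_pseudogroup:
  assumes "action_by_homeos G X \<phi>"
  shows "pseudogroup X (action_pseudogroup G X \<phi>)"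
  unfolding action_pseudogroup_def
  using assms by (intro pseudogroup_generated_pseudogroup)
    (auto simp: action_by_homeos_def intro: homeomorphic_map_in_Ph)

end

theory Submission
  imports Defs
begin

text \<open>
  A pseudo\<open>*\<close>group \<open>\<S>\<close> that generates the pseudogroup of the action need not contain the maps
  \<open>\<phi> g\<close>, only restrictions of them to small open sets. For the direction from left to right the
  difficulty is thus that a map \<open>\<phi> g\<close> which separates two points need not restrict to an element of
  \<open>\<S>\<close> defined at both.

  Passing to the generated pseudogroup adds only maps that are locally in \<open>\<S>\<close>
  (\<open>generated_pseudogroup_locally_in\<close>), so around each point every \<open>\<phi> a\<close> restricts to an element of
  \<open>\<S>\<close>. Let \<open>a\<close> range over a finite symmetric generating set. A Lebesgue number argument gives one
  \<open>\<delta> > 0\<close> such that each such \<open>\<phi> a\<close> restricts to an element of \<open>\<S>\<close> on a set that contains the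
  \<open>\<delta>\<close>-ball around any prescribed point. By compactness the action is also sensitive for the given
  metric, with some constant \<open>c\<close>. Then \<open>min c \<delta>\<close> is a sensitivity constant for \<open>\<S>\<close>: let \<open>y\<close> be close
  to \<open>x\<close> and \<open>d (\<phi> g x) (\<phi> g y) \<ge> c\<close>, write \<open>g\<close> as a word in the generators, and apply its letters
  one after the other to \<open>x\<close> and \<open>y\<close>. As long as the images are less than \<open>\<delta>\<close> apart, the next letter
  can be applied by composing with an element of \<open>\<S>\<close>. So either some element of \<open>\<S>\<close> moves the two
  points at least \<open>min c \<delta>\<close> apart before the word is exhausted, or an element of \<open>\<S>\<close> agrees with
  \<open>\<phi> g\<close> at \<open>x\<close> and \<open>y\<close> and moves them at least \<open>c\<close> apart.

  The converse is immediate, because the restrictions of the maps \<open>\<phi> g\<close> to open sets already form a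
  generating pseudo\<open>*\<close>group.
\<close>

section \<open>Extended metrics on compact spaces\<close>

lemma openin_ext_ball:
  assumes "compatible_metric X d" "x \<in> topspace X" "0 < r"
  shows "openin X (ext_ball (topspace X) d x r)"
proof -
  have X: "X = topology_generated_by {ext_ball (topspace X) d x r | x r. x \<in> topspace X \<and> 0 < r}"
    using assms(1) unfolding compatible_metric_def by blast
  have "openin (topology_generated_by {ext_ball (topspace X) d x r | x r. x \<in> topspace X \<and> 0 < r})
      (ext_ball (topspace X) d x r)"
    by (rule topology_generated_by_Basis) (use assms(2,3) in blast)
  then show ?thesis
    by (subst X)
qed

lemma centre_in_ext_ball:
  assumes "compatible_metric X d" "x \<in> topspace X" "0 < r"
  shows "x \<in> ext_ball (topspace X) d x r"
proof -
  have "d x x = 0"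
    using assms(1,2) unfolding compatible_metric_def ext_metric_on_def by blast
  then show ?thesis
    using assms(2,3) by (simp add: ext_ball_def)
qed

lemma ext_ball_mono: "r \<le> s \<Longrightarrow> ext_ball M d x r \<subseteq> ext_ball M d x s"
  unfolding ext_ball_def by (auto intro: less_le_trans ennreal_leI)

lemma ext_ball_subset_ext_ball:
  assumes "ext_metric_on M d" "x \<in> M" "y \<in> M" "d x y + ennreal s \<le> ennreal r"
  shows "ext_ball M d y s \<subseteq> ext_ball M d x r"
proof
  fix z assume z: "z \<in> ext_ball M d y s"
  then have "d x z \<le> d x y + d y z"
    using assms unfolding ext_metric_on_def ext_ball_def by blast
  moreover have "d x y \<noteq> \<infinity>"
    using assms(4) by (auto simp: top_unique)
  then have "d x y + d y z < d x y + ennreal s"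
    using z by (simp add: ext_ball_def ennreal_add_left_cancel_less)
  ultimately have "d x z < ennreal r"
    using assms(4) by (meson le_less_trans less_le_trans)
  then show "z \<in> ext_ball M d x r"
    using z by (simp add: ext_ball_def)
qed

text \<open>Balls are only required to form a subbase; the triangle inequality makes them a base. The
  radius \<open>r - d x y\<close> around \<open>y\<close> makes sense because a point of a ball of finite radius is at finite
  distance from the centre.\<close>

lemma openin_contains_ext_ball:
  assumes comp: "compatible_metric X d" and U: "openin X U" "y \<in> U"
  shows "\<exists>r>0. ext_ball (topspace X) d y r \<subseteq> U"
proof -
  let ?B = "{ext_ball (topspace X) d x r | x r. x \<in> topspace X \<and> 0 < r}"
  have m: "ext_metric_on (topspace X) d" and X: "X = topology_generated_by ?B"
    using comp unfolding compatible_metric_def by blast+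
  have "openin (topology_generated_by ?B) U"
    using U(1) by (subst (asm) X)
  then have "generate_topology_on ?B U"
    by (simp only: openin_topology_generated_by_iff)
  then show ?thesis
    using U(2)
  proof (induction arbitrary: y)
    case Empty
    then show ?case by simp
  next
    case (Int V W)
    then obtain r s where "0 < r" "ext_ball (topspace X) d y r \<subseteq> V"
      "0 < s" "ext_ball (topspace X) d y s \<subseteq> W"
      by blast
    then show ?case
      using ext_ball_mono[of "min r s" r] ext_ball_mono[of "min r s" s]
      by (intro exI[of _ "min r s"]) fastforce
  next
    case (UN K)
    then show ?case by blast
  next
    case (Basis V)
    then obtain x r where V: "V = ext_ball (topspace X) d x r" "x \<in> topspace X" "0 < r"
      by blast
    have y: "y \<in> topspace X" "d x y < ennreal r"
      using Basis.prems V(1) by (auto simp: ext_ball_def)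
    then obtain t where t: "0 \<le> t" "d x y = ennreal t"
      by (cases "d x y") auto
    have "t < r"
      using y(2) t by (simp add: ennreal_less_iff)
    then have "d x y + ennreal (r - t) \<le> ennreal r"
      using t by (simp flip: ennreal_plus)
    then show ?case
      using ext_ball_subset_ext_ball[OF m V(2) y(1)] V(1) \<open>t < r\<close> by (intro exI[of _ "r - t"]) auto
  qed
qed

text \<open>The existence of Lebesgue numbers, for metrics that may take the value \<open>\<infinity>\<close>.\<close>

lemma lebesgue_number_ext_metric:
  assumes comp: "compatible_metric X d" and K: "compact_space X"
    and cover: "\<And>x. x \<in> topspace X \<Longrightarrow> \<exists>U\<in>\<U>. openin X U \<and> x \<in> U"
  shows "\<exists>\<delta>>0. \<forall>x\<in>topspace X. \<exists>U\<in>\<U>. openin X U \<and> ext_ball (topspace X) d x \<delta> \<subseteq> U"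
proof -
  let ?B = "ext_ball (topspace X) d"
  have m: "ext_metric_on (topspace X) d"
    using comp unfolding compatible_metric_def by blast
  have "\<exists>r>0. \<exists>U\<in>\<U>. openin X U \<and> ?B x (2 * r) \<subseteq> U" if x: "x \<in> topspace X" for x
  proof -
    obtain U where U: "U \<in> \<U>" "openin X U" "x \<in> U"
      using cover[OF x] by blast
    obtain s where "s > 0" "?B x s \<subseteq> U"
      using openin_contains_ext_ball[OF comp U(2,3)] by blast
    then show ?thesis
      using U by (intro exI[of _ "s / 2"]) auto
  qed
  then obtain r where r: "\<And>x. x \<in> topspace X \<Longrightarrow> 0 < r x"
    "\<And>x. x \<in> topspace X \<Longrightarrow> \<exists>U\<in>\<U>. openin X U \<and> ?B x (2 * r x) \<subseteq> U"
    by metis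
  obtain \<F> where \<F>: "finite \<F>" "\<F> \<subseteq> (\<lambda>x. ?B x (r x)) ` topspace X" "topspace X \<subseteq> \<Union>\<F>"
  proof -
    have "\<forall>U\<in>(\<lambda>x. ?B x (r x)) ` topspace X. openin X U"
      using r(1) openin_ext_ball[OF comp] by blast
    moreover have "topspace X \<subseteq> \<Union>((\<lambda>x. ?B x (r x)) ` topspace X)"
      using r(1) centre_in_ext_ball[OF comp] by blast
    ultimately show thesis
      using K that unfolding compact_space_alt by meson
  qed
  then obtain F where F: "finite F" "F \<subseteq> topspace X" "\<F> = (\<lambda>x. ?B x (r x)) ` F"
    using finite_subset_image[OF \<F>(1,2)] by blast
  \<comment> \<open>The \<open>1\<close> covers the empty space, where \<open>F\<close> is empty.\<close>
  define \<delta> where "\<delta> = Min (insert 1 (r ` F))"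
  have \<delta>: "0 < \<delta>" "\<And>x. x \<in> F \<Longrightarrow> \<delta> \<le> r x"
    using F(1,2) r(1) by (auto simp: \<delta>_def)
  have "\<exists>U\<in>\<U>. openin X U \<and> ?B x \<delta> \<subseteq> U" if x: "x \<in> topspace X" for x
  proof -
    obtain z where z: "z \<in> F" "x \<in> ?B z (r z)"
      using \<F>(3) F(3) x by blast
    have zX: "z \<in> topspace X"
      using z F by blast
    have "d z x + ennreal \<delta> \<le> ennreal (r z) + ennreal (r z)"
      using z \<delta>(2)[OF z(1)] by (intro add_mono) (auto simp: ext_ball_def intro: ennreal_leI)
    also have "\<dots> = ennreal (2 * r z)"
      using r(1)[OF zX] by (simp flip: ennreal_plus)
    finally have "?B x \<delta> \<subseteq> ?B z (2 * r z)"
      by (intro ext_ball_subset_ext_ball[OF m zX x])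
    then show ?thesis
      using r(2)[OF zX] by blast
  qed
  then show ?thesis
    using \<delta>(1) by blast
qed

text \<open>A Lebesgue number for \<open>d'\<close> of the cover by \<open>d\<close>-balls of radius \<open>c / 2\<close> turns a \<open>d\<close>-separation of
  \<open>c\<close> into a \<open>d'\<close>-separation.\<close>

lemma action_sensitive_compatible_metric:
  assumes K: "compact_space X" and act: "action_by_homeos G X \<phi>"
    and comp: "compatible_metric X d" "compatible_metric X d'"
    and sens: "action_sensitive G X \<phi> d"
  shows "action_sensitive G X \<phi> d'"
proof -
  let ?B = "ext_ball (topspace X) d" and ?B' = "ext_ball (topspace X) d'"
  have m: "ext_metric_on (topspace X) d"
    using comp(1) unfolding compatible_metric_def by blast
  have maps: "\<phi> g x \<in> topspace X" if "g \<in> carrier G" "x \<in> topspace X" for g x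
    using act that group_action.element_image unfolding action_by_homeos_def by fast
  obtain c where c: "0 < c"
    "\<And>x r. x \<in> topspace X \<Longrightarrow> 0 < r \<Longrightarrow> \<exists>y\<in>?B x r. \<exists>g\<in>carrier G. ennreal c \<le> d (\<phi> g x) (\<phi> g y)"
    using sens unfolding action_sensitive_def by blast
  have "\<exists>U\<in>{?B z (c / 2) | z. z \<in> topspace X}. openin X U \<and> x \<in> U" if "x \<in> topspace X" for x
    using openin_ext_ball[OF comp(1) that] centre_in_ext_ball[OF comp(1) that] that c(1)
    by (intro bexI[of _ "?B x (c / 2)"]) auto
  then obtain c' where c': "0 < c'" "\<And>x. x \<in> topspace X \<Longrightarrow>
      \<exists>U\<in>{?B z (c / 2) | z. z \<in> topspace X}. openin X U \<and> ?B' x c' \<subseteq> U"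
    using lebesgue_number_ext_metric[OF comp(2) K, of "{?B z (c / 2) | z. z \<in> topspace X}"] by blast
  have sep: "ennreal c' \<le> d' u v"
    if uv: "u \<in> topspace X" "v \<in> topspace X" and far: "ennreal c \<le> d u v" for u v
  proof (rule ccontr)
    assume "\<not> ennreal c' \<le> d' u v"
    then have "v \<in> ?B' u c'"
      using uv by (simp add: ext_ball_def)
    moreover have "u \<in> ?B' u c'"
      using centre_in_ext_ball[OF comp(2) uv(1) c'(1)] .
    ultimately obtain z where z: "z \<in> topspace X" "u \<in> ?B z (c / 2)" "v \<in> ?B z (c / 2)"
      using c'(2)[OF uv(1)] by blast
    then have "d u v \<le> d z u + d z v"
      using m uv unfolding ext_metric_on_def by metis
    also have "\<dots> < ennreal (c / 2) + ennreal (c / 2)"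
      using z by (intro add_strict_mono) (auto simp: ext_ball_def)
    also have "\<dots> = ennreal c"
      using c(1) by (simp flip: ennreal_plus)
    finally show False
      using far by simp
  qed
  have "\<exists>y\<in>?B' x r. \<exists>g\<in>carrier G. ennreal c' \<le> d' (\<phi> g x) (\<phi> g y)"
    if x: "x \<in> topspace X" and r: "0 < r" for x r
  proof -
    obtain s where s: "0 < s" "?B x s \<subseteq> ?B' x r"
      using openin_contains_ext_ball[OF comp(1) openin_ext_ball[OF comp(2) x r]
          centre_in_ext_ball[OF comp(2) x r]] by blast
    obtain y g where yg: "y \<in> ?B x s" "g \<in> carrier G" "ennreal c \<le> d (\<phi> g x) (\<phi> g y)"
      using c(2)[OF x s(1)] by blast
    then have "y \<in> topspace X"
      by (simp add: ext_ball_def)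
    then have "ennreal c' \<le> d' (\<phi> g x) (\<phi> g y)"
      using sep maps x yg(2,3) by blast
    then show ?thesis
      using yg s(2) by blast
  qed
  then show ?thesis
    unfolding action_sensitive_def using c'(1) by blast
qed

section \<open>The pseudogroup generated by a pseudo*group\<close>

lemma map_inv_eq_Some_iff:
  assumes "f \<in> Ph X"
  shows "map_inv f y = Some x \<longleftrightarrow> f x = Some y"
proof -
  have "inj_on (\<lambda>x. the (f x)) (dom f)"
    using assms unfolding in_Ph_iff by blast
  then have inj: "u = v" if "f u = Some z" "f v = Some z" for u v z
    by (rule inj_onD[of "\<lambda>x. the (f x)" "dom f"]) (use that in auto)
  show ?thesis
  proof
    assume *: "map_inv f y = Some x"
    then obtain u where u: "f u = Some y" "x = (THE x. f x = Some y)"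
      by (auto simp: map_inv_def ran_def split: if_splits)
    moreover have "(THE x. f x = Some y) = u"
      by (rule the_equality[of _ u]) (use u(1) inj in blast)+
    ultimately show "f x = Some y" by simp
  next
    assume *: "f x = Some y"
    then have "(THE x. f x = Some y) = x"
      by (intro the_equality) (use inj in blast)+
    then show "map_inv f y = Some x"
      using * by (auto simp: map_inv_def ran_def)
  qed
qed

definition locally_in :: "'a topology \<Rightarrow> ('a \<rightharpoonup> 'a) set \<Rightarrow> ('a \<rightharpoonup> 'a) set" where
  "locally_in X \<S> = {f \<in> Ph X. \<forall>x\<in>dom f. \<exists>U. openin X U \<and> x \<in> U \<and> f |` U \<in> \<S>}"

text \<open>Around a given point, inverse and composition of local elements are the inverse and the
  composition of suitable elements of \<open>\<S>\<close>, whose domains serve as the required neighbourhoods.\<close>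

lemma pseudogroup_locally_in:
  assumes S: "pseudo_star_group X \<S>"
  shows "pseudogroup X (locally_in X \<S>)"
proof -
  have SPh: "\<S> \<subseteq> Ph X"
    and Sid: "Some |` topspace X \<in> \<S>"
    and Sinv: "\<And>f. f \<in> \<S> \<Longrightarrow> map_inv f \<in> \<S>"
    and Scomp: "\<And>f g. f \<in> \<S> \<Longrightarrow> g \<in> \<S> \<Longrightarrow> g \<circ>\<^sub>m f \<in> \<S>"
    and Sres: "\<And>f U. f \<in> \<S> \<Longrightarrow> openin X U \<Longrightarrow> U \<subseteq> dom f \<Longrightarrow> f |` U \<in> \<S>"
    using S unfolding pseudo_star_group_def by blast+
  have open_dom: "openin X (dom f)" if "f \<in> \<S>" for f
    using that SPh unfolding Ph_def by blast
  have locI: "f \<in> locally_in X \<S>"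
    if "f \<in> Ph X" "\<And>x y. f x = Some y \<Longrightarrow> \<exists>U. openin X U \<and> x \<in> U \<and> f |` U \<in> \<S>" for f
    using that unfolding locally_in_def by blast
  have locD: "\<exists>U. openin X U \<and> x \<in> U \<and> f |` U \<in> \<S>"
    if "f \<in> locally_in X \<S>" "f x = Some y" for f x y
    using that unfolding locally_in_def by blast
  have LPh: "locally_in X \<S> \<subseteq> Ph X"
    unfolding locally_in_def by blast
  have "Some |` topspace X \<in> locally_in X \<S>"
  proof (rule locI)
    show "Some |` topspace X \<in> Ph X" using Sid SPh by blast
    fix x y assume "(Some |` topspace X) x = Some y"
    then have "x \<in> topspace X" by (auto simp: restrict_map_def split: if_splits)
    then show "\<exists>U. openin X U \<and> x \<in> U \<and> Some |` topspace X |` U \<in> \<S>"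
      using Sid by (intro exI[of _ "topspace X"]) simp
  qed
  moreover have "map_inv f \<in> locally_in X \<S>" if f: "f \<in> locally_in X \<S>" for f
  proof (rule locI)
    have fPh: "f \<in> Ph X" using f LPh by blast
    then show "map_inv f \<in> Ph X" by (rule map_inv_in_Ph)
    fix y x assume "map_inv f y = Some x"
    then have xy: "f x = Some y" by (simp add: map_inv_eq_Some_iff[OF fPh])
    then obtain U where U: "openin X U" "x \<in> U" "f |` U \<in> \<S>"
      using locD[OF f] by blast
    have UPh: "f |` U \<in> Ph X" using U SPh by blast
    let ?V = "dom (map_inv (f |` U))"
    have "map_inv (f |` U) y = Some x"
      using xy U by (simp add: map_inv_eq_Some_iff[OF UPh])
    moreover have "map_inv f |` ?V = map_inv (f |` U)"
    proof
      fix z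
      show "(map_inv f |` ?V) z = map_inv (f |` U) z"
      proof (cases "map_inv (f |` U) z")
        case None
        then show ?thesis by (simp add: restrict_map_def dom_def)
      next
        case (Some u)
        then have "f u = Some z"
          using map_inv_eq_Some_iff[OF UPh] by (auto simp: restrict_map_def split: if_splits)
        then have "map_inv f z = Some u" by (simp add: map_inv_eq_Some_iff[OF fPh])
        then show ?thesis using Some by (auto simp: restrict_map_def)
      qed
    qed
    ultimately show "\<exists>V. openin X V \<and> y \<in> V \<and> map_inv f |` V \<in> \<S>"
      using Sinv[OF U(3)] open_dom by (intro exI[of _ ?V]) auto
  qed
  moreover have "g \<circ>\<^sub>m f \<in> locally_in X \<S>" if fg: "f \<in> locally_in X \<S>" "g \<in> locally_in X \<S>" for f g
  proof (rule locI)
    show "g \<circ>\<^sub>m f \<in> Ph X" using fg LPh map_comp_in_Ph by blast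
    fix x z assume "(g \<circ>\<^sub>m f) x = Some z"
    then obtain y where y: "f x = Some y" "g y = Some z"
      by (auto simp: map_comp_Some_iff)
    obtain U where U: "openin X U" "x \<in> U" "f |` U \<in> \<S>"
      using locD[OF fg(1) y(1)] by blast
    obtain V where V: "openin X V" "y \<in> V" "g |` V \<in> \<S>"
      using locD[OF fg(2) y(2)] by blast
    let ?h = "(g |` V) \<circ>\<^sub>m (f |` U)"
    have h: "?h \<in> \<S>" using Scomp U V by blast
    have "?h x = Some z" using y U V by (simp add: map_comp_def)
    moreover have "(g \<circ>\<^sub>m f) |` dom ?h = ?h"
    proof
      fix w
      show "((g \<circ>\<^sub>m f) |` dom ?h) w = ?h w"
        by (cases "?h w") (auto simp: restrict_map_def map_comp_def dom_def split: option.splits if_splits)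
    qed
    ultimately show "\<exists>W. openin X W \<and> x \<in> W \<and> (g \<circ>\<^sub>m f) |` W \<in> \<S>"
      using h open_dom[OF h] by (intro exI[of _ "dom ?h"]) auto
  qed
  moreover have "f |` V \<in> locally_in X \<S>"
    if f: "f \<in> locally_in X \<S>" and V: "openin X V" "V \<subseteq> dom f" for f V
  proof (rule locI)
    show "f |` V \<in> Ph X" using f V LPh restrict_in_Ph by blast
    fix x y assume "(f |` V) x = Some y"
    then have xy: "f x = Some y" "x \<in> V" by (auto simp: restrict_map_def split: if_splits)
    obtain U where U: "openin X U" "x \<in> U" "f |` U \<in> \<S>"
      using locD[OF f xy(1)] by blast
    have "f |` V |` (U \<inter> V) = f |` U |` (U \<inter> V)"
      by (rule ext) (auto simp: restrict_map_def)
    moreover have "f |` U |` (U \<inter> V) \<in> \<S>"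
      by (rule Sres[OF U(3)]) (use U V in auto)
    ultimately show "\<exists>W. openin X W \<and> x \<in> W \<and> f |` V |` W \<in> \<S>"
      using U V xy by (intro exI[of _ "U \<inter> V"]) auto
  qed
  moreover have "f \<in> locally_in X \<S>"
    if f: "f \<in> Ph X" "\<forall>x\<in>dom f. \<exists>U. openin X U \<and> x \<in> U \<and> f |` U \<in> locally_in X \<S>" for f
  proof (rule locI[OF f(1)])
    fix x y assume xy: "f x = Some y"
    then obtain U where U: "openin X U" "x \<in> U" "f |` U \<in> locally_in X \<S>"
      using f(2) by blast
    then obtain W where W: "openin X W" "x \<in> W" "f |` U |` W \<in> \<S>"
      using locD[OF U(3), of x y] xy by auto
    then show "\<exists>U. openin X U \<and> x \<in> U \<and> f |` U \<in> \<S>"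
      using U by (intro exI[of _ "U \<inter> W"]) auto
  qed
  ultimately show ?thesis
    unfolding pseudogroup_def pseudo_star_group_def using LPh by blast
qed

lemma generated_pseudogroup_locally_in:
  assumes S: "pseudo_star_group X \<S>"
    and f: "f \<in> generated_pseudogroup X \<S>" and x: "x \<in> dom f"
  shows "\<exists>U. openin X U \<and> x \<in> U \<and> f |` U \<in> \<S>"
proof -
  have "h \<in> locally_in X \<S>" if h: "h \<in> \<S>" for h
  proof -
    have hPh: "h \<in> Ph X" using S h unfolding pseudo_star_group_def by blast
    have "h |` dom h = h" by (rule ext) (simp add: restrict_map_def dom_def)
    moreover have "openin X (dom h)" using hPh unfolding Ph_def by blast
    ultimately show ?thesis
      unfolding locally_in_def using h hPh by (intro CollectI conjI ballI exI[of _ "dom h"]) auto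
  qed
  then have "f \<in> locally_in X \<S>"
    using generated_pseudogroup_least[OF pseudogroup_locally_in[OF S]] f by blast
  then show ?thesis
    using x unfolding locally_in_def by blast
qed

section \<open>The pseudo*group of restrictions of an action\<close>

definition action_restrictions ::
    "('g, 'b) monoid_scheme \<Rightarrow> 'a topology \<Rightarrow> ('g \<Rightarrow> 'a \<Rightarrow> 'a) \<Rightarrow> ('a \<rightharpoonup> 'a) set" where
  "action_restrictions G X \<phi> = {(\<lambda>x. Some (\<phi> g x)) |` U | g U. g \<in> carrier G \<and> openin X U}"

lemma action_restrictions_eq_restrict:
  assumes "openin X U"
  shows "(\<lambda>x. Some (\<phi> g x)) |` U = (\<lambda>x. Some (\<phi> g x)) |` topspace X |` U"
  using openin_subset[OF assms] by (simp add: Int_absorb1)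

lemma action_restrictions_subset_Ph:
  assumes act: "action_by_homeos G X \<phi>"
  shows "action_restrictions G X \<phi> \<subseteq> Ph X"
proof -
  have "(\<lambda>x. Some (\<phi> g x)) |` U \<in> Ph X" if "g \<in> carrier G" "openin X U" for g U
    unfolding action_restrictions_eq_restrict[OF that(2)]
    using act that unfolding action_by_homeos_def
    by (intro restrict_in_Ph homeomorphic_map_in_Ph) auto
  then show ?thesis
    unfolding action_restrictions_def by blast
qed

lemma pseudo_star_group_action_restrictions:
  assumes act: "action_by_homeos G X \<phi>"
  shows "pseudo_star_group X (action_restrictions G X \<phi>)"
proof -
  interpret group_action G "topspace X" \<phi>
    using act unfolding action_by_homeos_def by blast
  interpret group G
    using group_hom unfolding group_hom_def by blast
  let ?R = "action_restrictions G X \<phi>"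
  let ?m = "\<lambda>g U. (\<lambda>x. Some (\<phi> g x)) |` U"
  have RI: "?m g U \<in> ?R" if "g \<in> carrier G" "openin X U" for g U
    using that unfolding action_restrictions_def by blast
  have RE: "\<exists>g U. g \<in> carrier G \<and> openin X U \<and> U \<subseteq> topspace X \<and> f = ?m g U" if "f \<in> ?R" for f
    using that openin_subset unfolding action_restrictions_def by blast
  note RPh = action_restrictions_subset_Ph[OF act]
  have "Some |` topspace X \<in> ?R"
  proof -
    have "?m \<one>\<^bsub>G\<^esub> (topspace X) = Some |` topspace X"
      by (rule ext) (simp add: restrict_map_def flip: id_eq_one)
    then show ?thesis
      using RI[of "\<one>\<^bsub>G\<^esub>" "topspace X"] by simp
  qed
  moreover have "map_inv f \<in> ?R" if f: "f \<in> ?R" for f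
  proof -
    obtain g U where g: "g \<in> carrier G" "openin X U" "U \<subseteq> topspace X" "f = ?m g U"
      using RE[OF f] by blast
    have iPh: "map_inv f \<in> Ph X" and fPh: "f \<in> Ph X"
      using f RPh map_inv_in_Ph by blast+
    have "map_inv f = ?m (inv\<^bsub>G\<^esub> g) (dom (map_inv f))"
    proof
      fix y
      show "map_inv f y = ?m (inv\<^bsub>G\<^esub> g) (dom (map_inv f)) y"
      proof (cases "map_inv f y")
        case None
        then show ?thesis by (simp add: restrict_map_def dom_def)
      next
        case (Some x)
        then have "f x = Some y" by (simp add: map_inv_eq_Some_iff[OF fPh])
        then have "x \<in> topspace X" "\<phi> g x = y"
          using g by (auto simp: restrict_map_def split: if_splits)
        then have "\<phi> (inv\<^bsub>G\<^esub> g) y = x"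
          using orbit_sym_aux g(1) by blast
        then show ?thesis using Some by (simp add: restrict_map_def dom_def)
      qed
    qed
    moreover have "openin X (dom (map_inv f))"
      using iPh unfolding Ph_def by blast
    ultimately show ?thesis
      using RI[of "inv\<^bsub>G\<^esub> g" "dom (map_inv f)"] g(1) by simp
  qed
  moreover have "h \<circ>\<^sub>m f \<in> ?R" if fh: "f \<in> ?R" "h \<in> ?R" for f h
  proof -
    obtain g U where g: "g \<in> carrier G" "openin X U" "U \<subseteq> topspace X" "f = ?m g U"
      using RE[OF fh(1)] by blast
    obtain k V where k: "k \<in> carrier G" "openin X V" "V \<subseteq> topspace X" "h = ?m k V"
      using RE[OF fh(2)] by blast
    have cPh: "h \<circ>\<^sub>m f \<in> Ph X"
      using fh RPh map_comp_in_Ph by blast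
    have "(h \<circ>\<^sub>m f) = ?m (k \<otimes>\<^bsub>G\<^esub> g) (dom (h \<circ>\<^sub>m f))"
      using g k composition_rule[of _ k g]
      by (intro ext) (auto simp: restrict_map_def map_comp_def subset_iff dom_def)
    moreover have "openin X (dom (h \<circ>\<^sub>m f))"
      using cPh unfolding Ph_def by blast
    ultimately show ?thesis
      using RI[of "k \<otimes>\<^bsub>G\<^esub> g" "dom (h \<circ>\<^sub>m f)"] g(1) k(1) by simp
  qed
  moreover have "f |` W \<in> ?R" if f: "f \<in> ?R" "openin X W" "W \<subseteq> dom f" for f W
  proof -
    obtain g U where g: "g \<in> carrier G" "openin X U" "f = ?m g U"
      using RE[OF f(1)] by blast
    then show ?thesis
      using RI[of g "U \<inter> W"] f(2) by (simp add: openin_Int)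
  qed
  ultimately show ?thesis
    unfolding pseudo_star_group_def using RPh by blast
qed

lemma generated_pseudogroup_action_restrictions:
  assumes act: "action_by_homeos G X \<phi>"
  shows "generated_pseudogroup X (action_restrictions G X \<phi>) = action_pseudogroup G X \<phi>"
proof
  let ?m = "\<lambda>g U. (\<lambda>x. Some (\<phi> g x)) |` U"
  have P: "pseudogroup X (action_pseudogroup G X \<phi>)"
    by (rule pseudogroup_action_pseudogroup[OF act])
  have "?m g U \<in> action_pseudogroup G X \<phi>" if g: "g \<in> carrier G" and U: "openin X U" for g U
  proof -
    have "?m g (topspace X) \<in> action_pseudogroup G X \<phi>"
      unfolding action_pseudogroup_def by (rule subsetD[OF subset_generated_pseudogroup]) (use g in blast)
    moreover have "U \<subseteq> dom (?m g (topspace X))"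
      using openin_subset[OF U] by auto
    ultimately have "?m g (topspace X) |` U \<in> action_pseudogroup G X \<phi>"
      using P U unfolding pseudogroup_def pseudo_star_group_def by blast
    then show ?thesis
      using action_restrictions_eq_restrict[OF U] by metis
  qed
  then show "generated_pseudogroup X (action_restrictions G X \<phi>) \<subseteq> action_pseudogroup G X \<phi>"
    unfolding action_restrictions_def by (intro generated_pseudogroup_least[OF P]) blast
  have "{?m g (topspace X) | g. g \<in> carrier G} \<subseteq> action_restrictions G X \<phi>"
    unfolding action_restrictions_def by blast
  then show "action_pseudogroup G X \<phi> \<subseteq> generated_pseudogroup X (action_restrictions G X \<phi>)"
    unfolding action_pseudogroup_def
    using subset_generated_pseudogroup[of "action_restrictions G X \<phi>" X]
    by (intro generated_pseudogroup_least pseudogroup_generated_pseudogroup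
        action_restrictions_subset_Ph[OF act]) blast
qed

lemma action_sensitive_if_pseudogroup_sensitive:
  assumes act: "action_by_homeos G X \<phi>" and comp: "compatible_metric X d"
    and sens: "pseudogroup_sensitive X (action_pseudogroup G X \<phi>)"
  shows "action_sensitive G X \<phi> d"
proof -
  let ?R = "action_restrictions G X \<phi>"
  have "?R \<subseteq> action_pseudogroup G X \<phi>"
    using subset_generated_pseudogroup generated_pseudogroup_action_restrictions[OF act] by metis
  then have "pseudo_star_group_sensitive X ?R d"
    using sens comp pseudo_star_group_action_restrictions[OF act]
      generated_pseudogroup_action_restrictions[OF act]
    unfolding pseudogroup_sensitive_def by blast
  then obtain c where c: "0 < c"
    "\<And>x r. x \<in> topspace X \<Longrightarrow> 0 < r \<Longrightarrow> \<exists>s\<in>?R. \<exists>y. x \<in> dom s \<and> y \<in> dom s \<and> d x y < ennreal r \<and>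
       ennreal c \<le> d (the (s x)) (the (s y))"
    unfolding pseudo_star_group_sensitive_def by (elim exE conjE) simp
  have "\<exists>y\<in>ext_ball (topspace X) d x r. \<exists>g\<in>carrier G. ennreal c \<le> d (\<phi> g x) (\<phi> g y)"
    if xr: "x \<in> topspace X" "0 < r" for x r
  proof -
    obtain s y where s: "s \<in> ?R" "x \<in> dom s" "y \<in> dom s" "d x y < ennreal r"
      "ennreal c \<le> d (the (s x)) (the (s y))"
      using c(2)[OF xr] by blast
    then obtain g U where g: "g \<in> carrier G" "openin X U" "s = (\<lambda>x. Some (\<phi> g x)) |` U"
      unfolding action_restrictions_def by blast
    then show ?thesis
      using s openin_subset[OF g(2)]
      by (intro bexI[of _ y] bexI[of _ g]) (auto simp: ext_ball_def)
  qed
  then show ?thesis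
    unfolding action_sensitive_def using c(1) by blast
qed

section \<open>Following a word in the generators\<close>

text \<open>For a single letter the Lebesgue number is that of the cover by the open sets on which its map
  restricts to an element of \<open>\<S>\<close>; finiteness of \<open>B\<close> is what makes a uniform choice possible.\<close>

lemma uniform_local_restrictions:
  assumes K: "compact_space X" and comp: "compatible_metric X d"
    and S: "pseudo_star_group X \<S>" and gen: "generated_pseudogroup X \<S> = action_pseudogroup G X \<phi>"
    and B: "finite B" "B \<subseteq> carrier G"
  shows "\<exists>\<delta>>0. \<forall>b\<in>B. \<forall>x\<in>topspace X.
       \<exists>U. (\<lambda>x. Some (\<phi> b x)) |` U \<in> \<S> \<and> ext_ball (topspace X) d x \<delta> \<subseteq> U"
proof -
  let ?m = "\<lambda>g U. (\<lambda>x. Some (\<phi> g x)) |` U"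
  have "\<exists>\<delta>>0. \<forall>x\<in>topspace X. \<exists>U. ?m b U \<in> \<S> \<and> ext_ball (topspace X) d x \<delta> \<subseteq> U"
    if b: "b \<in> B" for b
  proof -
    have "\<exists>U\<in>{U. ?m b U \<in> \<S>}. openin X U \<and> x \<in> U" if x: "x \<in> topspace X" for x
    proof -
      have "?m b (topspace X) \<in> generated_pseudogroup X \<S>"
        unfolding gen action_pseudogroup_def
        by (rule subsetD[OF subset_generated_pseudogroup]) (use b B in blast)
      then obtain U where U: "openin X U" "x \<in> U" "?m b (topspace X) |` U \<in> \<S>"
        using generated_pseudogroup_locally_in[OF S, of "?m b (topspace X)" x] x by auto
      then show ?thesis
        unfolding action_restrictions_eq_restrict[OF U(1), of \<phi> b, symmetric] by blast
    qed
    then show ?thesis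
      using lebesgue_number_ext_metric[OF comp K, of "{U. ?m b U \<in> \<S>}"] by blast
  qed
  then obtain \<delta> where \<delta>: "\<And>b. b \<in> B \<Longrightarrow> 0 < \<delta> b"
    "\<And>b x. b \<in> B \<Longrightarrow> x \<in> topspace X \<Longrightarrow> \<exists>U. ?m b U \<in> \<S> \<and> ext_ball (topspace X) d x (\<delta> b) \<subseteq> U"
    by metis
  let ?\<delta> = "Min (insert 1 (\<delta> ` B))"
  have "0 < ?\<delta>"
    using B(1) \<delta>(1) by auto
  moreover have "ext_ball (topspace X) d x ?\<delta> \<subseteq> ext_ball (topspace X) d x (\<delta> b)" if "b \<in> B" for b x
    using B(1) that by (intro ext_ball_mono) auto
  ultimately show ?thesis
    using \<delta>(2) by (meson subset_trans)
qed

text \<open>The hypothesis \<open>near\<close> says that \<open>\<S>\<close> never moves \<open>x\<close> and \<open>y\<close> as far as \<open>\<delta>\<close> apart; it makes the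
  next letter applicable at every stage of the word. The statement starts from an arbitrary
  \<open>t \<in> \<S>\<close> in place of the identity so that the words for the two factors of a product can be
  followed one after the other.\<close>

lemma follow_generated_element:
  assumes act: "action_by_homeos G X \<phi>" and S: "pseudo_star_group X \<S>"
    and A: "A \<subseteq> carrier G"
    and local: "\<And>b u. b \<in> A \<union> m_inv G ` A \<Longrightarrow> u \<in> topspace X \<Longrightarrow>
       \<exists>U. (\<lambda>x. Some (\<phi> b x)) |` U \<in> \<S> \<and> ext_ball (topspace X) d u \<delta> \<subseteq> U"
    and near: "\<And>s u v. s \<in> \<S> \<Longrightarrow> s x = Some u \<Longrightarrow> s y = Some v \<Longrightarrow>
       u \<in> ext_ball (topspace X) d u \<delta> \<and> v \<in> ext_ball (topspace X) d u \<delta>"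
    and g: "g \<in> generate G A" and t: "t \<in> \<S>" "t x = Some u" "t y = Some v"
  shows "\<exists>s\<in>\<S>. s x = Some (\<phi> g u) \<and> s y = Some (\<phi> g v)"
proof -
  interpret group_action G "topspace X" \<phi>
    using act unfolding action_by_homeos_def by blast
  interpret group G
    using group_hom unfolding group_hom_def by blast
  have in_X: "u \<in> topspace X" "v \<in> topspace X"
    if "s \<in> \<S>" "s x = Some u" "s y = Some v" for s u v
    using near[OF that] by (auto simp: ext_ball_def)
  have letter: "\<exists>s\<in>\<S>. s x = Some (\<phi> b u) \<and> s y = Some (\<phi> b v)"
    if b: "b \<in> A \<union> m_inv G ` A" and t: "t \<in> \<S>" "t x = Some u" "t y = Some v" for b t u v
  proof -
    obtain U where U: "(\<lambda>x. Some (\<phi> b x)) |` U \<in> \<S>" "ext_ball (topspace X) d u \<delta> \<subseteq> U"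
      using local[OF b in_X(1)[OF t]] by blast
    have "(\<lambda>x. Some (\<phi> b x)) |` U \<circ>\<^sub>m t \<in> \<S>"
      using S t(1) U(1) unfolding pseudo_star_group_def by blast
    moreover have "u \<in> U" "v \<in> U"
      using near[OF t] U(2) by auto
    ultimately show ?thesis
      using t(2,3) by (intro bexI[of _ "(\<lambda>x. Some (\<phi> b x)) |` U \<circ>\<^sub>m t"]) (auto simp: map_comp_def)
  qed
  show ?thesis
    using g t
  proof (induction arbitrary: t u v)
    case one
    have "\<phi> \<one>\<^bsub>G\<^esub> u = u" "\<phi> \<one>\<^bsub>G\<^esub> v = v"
      using in_X[OF one] by (simp_all flip: id_eq_one)
    then show ?case
      using one by auto
  next
    case (incl a)
    then show ?case by (intro letter[OF _ incl.prems]) blast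
  next
    case (inv a)
    then show ?case by (intro letter[OF _ inv.prems]) blast
  next
    case (eng h k)
    have "h \<in> carrier G" "k \<in> carrier G"
      using eng.hyps generate_in_carrier[OF A] by blast+
    then have "\<phi> (h \<otimes>\<^bsub>G\<^esub> k) u = \<phi> h (\<phi> k u)" "\<phi> (h \<otimes>\<^bsub>G\<^esub> k) v = \<phi> h (\<phi> k v)"
      using composition_rule in_X[OF eng.prems] by blast+
    moreover obtain s where "s \<in> \<S>" "s x = Some (\<phi> k u)" "s y = Some (\<phi> k v)"
      using eng.IH(2)[OF eng.prems] by blast
    ultimately show ?case
      using eng.IH(1) by simp
  qed
qed

lemma pseudogroup_sensitive_if_action_sensitive:
  assumes fg: "finitely_generated_group G" and K: "compact_space X"
    and act: "action_by_homeos G X \<phi>" and comp: "compatible_metric X d"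
    and sens: "action_sensitive G X \<phi> d"
  shows "pseudogroup_sensitive X (action_pseudogroup G X \<phi>)"
  unfolding pseudogroup_sensitive_def
proof (intro allI impI, elim conjE)
  fix \<S> d'
  assume S: "pseudo_star_group X \<S>" "generated_pseudogroup X \<S> = action_pseudogroup G X \<phi>"
    and comp': "compatible_metric X d'"
  interpret group G
    using fg unfolding finitely_generated_group_def by blast
  have SPh: "\<S> \<subseteq> Ph X" and Sid: "Some |` topspace X \<in> \<S>"
    using S(1) unfolding pseudo_star_group_def by blast+
  obtain A where A: "finite A" "A \<subseteq> carrier G" "generate G A = carrier G"
    using fg unfolding finitely_generated_group_def by blast
  obtain \<delta> :: real where \<delta>: "0 < \<delta>"
    "\<And>b x. b \<in> A \<union> m_inv G ` A \<Longrightarrow> x \<in> topspace X \<Longrightarrow>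
       \<exists>U. (\<lambda>x. Some (\<phi> b x)) |` U \<in> \<S> \<and> ext_ball (topspace X) d' x \<delta> \<subseteq> U"
    using uniform_local_restrictions[OF K comp' S, of "A \<union> m_inv G ` A"] A by blast
  have "action_sensitive G X \<phi> d'"
    by (rule action_sensitive_compatible_metric[OF K act comp comp' sens])
  then obtain c where c: "0 < c" "\<And>x r. x \<in> topspace X \<Longrightarrow> 0 < r \<Longrightarrow>
      \<exists>y\<in>ext_ball (topspace X) d' x r. \<exists>g\<in>carrier G. ennreal c \<le> d' (\<phi> g x) (\<phi> g y)"
    unfolding action_sensitive_def by blast
  define e where "e = min c \<delta>"
  have e: "ennreal e \<le> ennreal c" "ennreal e \<le> ennreal \<delta>" "0 < e"
    using c(1) \<delta>(1) by (auto simp: e_def intro!: ennreal_leI)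
  have "\<exists>s\<in>\<S>. \<exists>y. x \<in> dom s \<and> y \<in> dom s \<and> d' x y < ennreal r \<and> ennreal e \<le> d' (the (s x)) (the (s y))"
    if xr: "x \<in> topspace X" "0 < r" for x r
  proof (rule ccontr)
    assume none: "\<not> ?thesis"
    obtain y g where y: "y \<in> ext_ball (topspace X) d' x r" and g: "g \<in> carrier G"
      "ennreal c \<le> d' (\<phi> g x) (\<phi> g y)"
      using c(2)[OF xr] by blast
    have yX: "y \<in> topspace X" "d' x y < ennreal r"
      using y by (auto simp: ext_ball_def)
    have close: "d' u v < ennreal e" if "s \<in> \<S>" "s x = Some u" "s y = Some v" for s u v
    proof -
      have "x \<in> dom s" "y \<in> dom s" "the (s x) = u" "the (s y) = v"
        using that(2,3) by auto
      then show ?thesis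
        using none that(1) yX(2) not_le by metis
    qed
    have near: "u \<in> ext_ball (topspace X) d' u \<delta> \<and> v \<in> ext_ball (topspace X) d' u \<delta>"
      if s: "s \<in> \<S>" "s x = Some u" "s y = Some v" for s u v
    proof -
      have "ran s \<subseteq> topspace X"
        using s(1) SPh openin_subset unfolding Ph_def by blast
      then have uv: "u \<in> topspace X" "v \<in> topspace X"
        using s(2,3) by (auto simp: ran_def)
      have "d' u v < ennreal \<delta>"
        using close[OF s] e(2) by (rule less_le_trans)
      then show ?thesis
        using uv centre_in_ext_ball[OF comp' uv(1) \<delta>(1)] by (simp add: ext_ball_def)
    qed
    have g': "g \<in> generate G A"
      using g(1) A(3) by simp
    have "\<exists>s\<in>\<S>. s x = Some (\<phi> g x) \<and> s y = Some (\<phi> g y)"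
      by (rule follow_generated_element[OF act S(1) A(2) _ _ g' Sid, where \<delta> = \<delta>])
        (fact \<delta>(2) near | use xr yX in simp)+
    then have "d' (\<phi> g x) (\<phi> g y) < ennreal e"
      using close by blast
    then show False
      using g(2) e(1) by (meson leD le_less_trans less_le_trans)
  qed
  then show "pseudo_star_group_sensitive X \<S> d'"
    unfolding pseudo_star_group_sensitive_def using e(3) by (intro exI[of _ e]) simp
qed

theorem theorem1p7:
  fixes G :: "('g, 'b) monoid_scheme"
    and X :: "'a topology"
    and \<phi> :: "'g \<Rightarrow> 'a \<Rightarrow> 'a"
    and d :: "'a \<Rightarrow> 'a \<Rightarrow> ennreal"
  assumes "finitely_generated_group G"
    and "compact_space X"
    and "polish_topology X"
    and "action_by_homeos G X \<phi>"
    and "compatible_metric X d"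
  shows "action_sensitive G X \<phi> d \<longleftrightarrow> pseudogroup_sensitive X (action_pseudogroup G X \<phi>)"
  using pseudogroup_sensitive_if_action_sensitive[OF assms(1,2,4,5)]
    action_sensitive_if_pseudogroup_sensitive[OF assms(4,5)] by blast

end
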